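(* For any $0<\beta<1$ and $0\le\theta\le 1$ there exist a variable diffusivity coefficient $K=K(x,\beta,\theta)$ on $(0,1)$ with positive lower and upper bounds and a function $w\in H^{1-\beta/2}_0(0,1)$ such that $B(w,w)<0$, where $B(u,v)=\theta\langle K\,{}_0^{l}I_x^{\beta}Du,Dv\rangle+(1-\theta)\langle K\,{}_x^{r}I_1^{\beta}Du,Dv\rangle$. In fact, $K$ can be chosen as piecewise constant with just three pieces, or as a smooth modification of such a piecewise constant function.
   Context: $D$ is the first-order derivative in $x$. For $\sigma>0$ and $w\in L^1(0,1)$ the left and right fractional integrals are ${}_0^{l}I_x^{\sigma}w(x)=\frac1{\Gamma(\sigma)}\int_0^x\frac{w(s)}{(x-s)^{1-\sigma}}\,ds$ and ${}_x^{r}I_1^{\sigma}w(x)=\frac1{\Gamma(\sigma)}\int_x^1\frac{w(s)}{(s-x)^{1-\sigma}}\,ds$. For $\mu>0$, $H^\mu_0(0,1)$ is the completion of $C_0^\infty(0,1)$ (functions extended by zero) in the norm $\|w\|_{H^\mu(\mathbb{R})}=\big(\|w\|_{L^2(\mathbb{R})}^2+\||\omega|^\mu\mathcal{F}(w)\|_{L^2(\mathbb{R})}^2\big)^{1/2}$, where $\mathcal{F}$ is the Fourier transform. The form $B$ is the variable-coefficient analogue of the Galerkin bilinear form; the pairing $\langle\cdot,\cdot\rangle$ extends the $L^2(0,1)$ inner product, so $B(w,w)=\int_0^1 K(x)\big(\theta\,{}_0^{l}I_x^{\beta}Dw+(1-\theta)\,{}_x^{r}I_1^{\beta}Dw\big)(x)\,Dw(x)\,dx$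 whenever this integral makes sense (for instance for $w\in H^1_0(0,1)$). *)

theory Defs
  imports "HOL-Analysis.Analysis"
begin

definition smooth_on :: "real set \<Rightarrow> (real \<Rightarrow> real) \<Rightarrow> bool" where
  "smooth_on S f \<longleftrightarrow> (\<forall>n. \<forall>x\<in>S. ((deriv ^^ n) f) differentiable (at x))"

definition test_function :: "(real \<Rightarrow> real) \<Rightarrow> bool" where
  "test_function \<phi> \<longleftrightarrow> smooth_on UNIV \<phi> \<and>
     (\<exists>a b. 0 < a \<and> a < b \<and> b < 1 \<and> (\<forall>x. x \<notin> {a..b} \<longrightarrow> \<phi> x = 0))"

definition fourier :: "(real \<Rightarrow> real) \<Rightarrow> real \<Rightarrow> complex" where
  "fourier w \<omega> = (LINT x|lborel. cis (- (\<omega> * x)) * complex_of_real (w x))"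

text \<open>
  The square of the norm of \<open>H\<^sup>\<mu>(\<real>)\<close>, possibly infinite. It is only applied to functions
  vanishing outside \<open>(0,1)\<close>, for which square integrability gives integrability, so that the
  Fourier integral needs no extension to \<open>L\<^sup>2\<close>.
\<close>

definition sobolev_norm_sq :: "real \<Rightarrow> (real \<Rightarrow> real) \<Rightarrow> ennreal" where
  "sobolev_norm_sq \<mu> w =
     (\<integral>\<^sup>+x. ennreal ((w x)\<^sup>2) \<partial>lborel) +
     (\<integral>\<^sup>+\<omega>. ennreal ((\<bar>\<omega>\<bar> powr \<mu> * cmod (fourier w \<omega>))\<^sup>2) \<partial>lborel)"

definition approximates :: "real \<Rightarrow> (nat \<Rightarrow> real \<Rightarrow> real) \<Rightarrow> (real \<Rightarrow> real) \<Rightarrow> bool" where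
  "approximates \<mu> \<phi> w \<longleftrightarrow> (\<forall>n. test_function (\<phi> n)) \<and>
     (\<lambda>n. sobolev_norm_sq \<mu> (\<lambda>x. \<phi> n x - w x)) \<longlonglongrightarrow> 0"

text \<open>
  The completion of the test functions, realised as their closure inside \<open>L\<^sup>2(\<real>)\<close>. Elements are
  representatives extended by zero outside \<open>(0,1)\<close>.
\<close>

definition H0 :: "real \<Rightarrow> (real \<Rightarrow> real) set" where
  "H0 \<mu> = {w. w \<in> borel_measurable lborel \<and> (\<forall>x. x \<notin> {0<..<1} \<longrightarrow> w x = 0) \<and>
              (\<exists>\<phi>. approximates \<mu> \<phi> w)}"

definition frac_int_left :: "real \<Rightarrow> (real \<Rightarrow> real) \<Rightarrow> real \<Rightarrow> real" where
  "frac_int_left \<sigma> w x =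
     1 / Gamma \<sigma> * (LINT s:{0<..<x}|lborel. w s / (x - s) powr (1 - \<sigma>))"

definition frac_int_right :: "real \<Rightarrow> (real \<Rightarrow> real) \<Rightarrow> real \<Rightarrow> real" where
  "frac_int_right \<sigma> w x =
     1 / Gamma \<sigma> * (LINT s:{x<..<1}|lborel. w s / (s - x) powr (1 - \<sigma>))"

definition square_integrable :: "(real \<Rightarrow> real) \<Rightarrow> bool" where
  "square_integrable g \<longleftrightarrow> set_borel_measurable lborel {0<..<1} g \<and>
     set_integrable lborel {0<..<1} (\<lambda>x. (g x)\<^sup>2)"

definition weak_derivative :: "(real \<Rightarrow> real) \<Rightarrow> (real \<Rightarrow> real) \<Rightarrow> bool" where
  "weak_derivative w g \<longleftrightarrow>
     set_integrable lborel {0<..<1} w \<and> set_integrable lborel {0<..<1} g \<and>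
     (\<forall>\<phi>. test_function \<phi> \<longrightarrow>
        (LINT x:{0<..<1}|lborel. w x * deriv \<phi> x) = - (LINT x:{0<..<1}|lborel. g x * \<phi> x))"

text \<open>The bilinear form in terms of the derivatives \<open>du\<close>, \<open>dv\<close>, with \<open>L\<^sup>2\<close> inner products.\<close>

definition L2_form ::
  "(real \<Rightarrow> real) \<Rightarrow> real \<Rightarrow> real \<Rightarrow> (real \<Rightarrow> real) \<Rightarrow> (real \<Rightarrow> real) \<Rightarrow> real" where
  "L2_form K \<beta> \<theta> du dv =
     \<theta> * (LINT x:{0<..<1}|lborel. K x * frac_int_left \<beta> du x * dv x) +
     (1 - \<theta>) * (LINT x:{0<..<1}|lborel. K x * frac_int_right \<beta> du x * dv x)"

text \<open>
  \<open>B_value K \<beta> \<theta> u v y\<close> says that \<open>B(u,v)\<close> is defined and equals \<open>y\<close>, for \<open>u\<close> and \<open>v\<close> in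
  \<open>H\<^sub>0\<close> of order \<open>1 - \<beta>/2\<close>. If the derivatives are square integrable, the pairing is the
  \<open>L\<^sup>2\<close> inner product; in general it is the extension by continuity from the test functions.
  For bounded measurable \<open>K\<close> both rules give the same value where both apply, since \<open>u\<close> and \<open>v\<close> with square integrable
  derivatives are limits of test functions in \<open>H\<^sup>1\<close>. A relation is used so that
  no default value is attached to a pairing that does not exist.
\<close>

inductive B_value ::
  "(real \<Rightarrow> real) \<Rightarrow> real \<Rightarrow> real \<Rightarrow> (real \<Rightarrow> real) \<Rightarrow> (real \<Rightarrow> real) \<Rightarrow> real \<Rightarrow> bool"
  for K \<beta> \<theta> u v where
  L2_pairing:
    "B_value K \<beta> \<theta> u v (L2_form K \<beta> \<theta> du dv)"
    if "u \<in> H0 (1 - \<beta> / 2)" "v \<in> H0 (1 - \<beta> / 2)"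
       "weak_derivative u du" "square_integrable du"
       "weak_derivative v dv" "square_integrable dv"
| extended_pairing:
    "B_value K \<beta> \<theta> u v y"
    if "u \<in> H0 (1 - \<beta> / 2)" "v \<in> H0 (1 - \<beta> / 2)"
       "\<And>\<phi> \<psi>. approximates (1 - \<beta> / 2) \<phi> u \<Longrightarrow> approximates (1 - \<beta> / 2) \<psi> v \<Longrightarrow>
          (\<lambda>n. L2_form K \<beta> \<theta> (deriv (\<phi> n)) (deriv (\<psi> n))) \<longlonglongrightarrow> y"

definition diffusivity :: "(real \<Rightarrow> real) \<Rightarrow> bool" where
  "diffusivity K \<longleftrightarrow> set_borel_measurable lborel {0<..<1} K \<and>
     (\<exists>m M. 0 < m \<and> (\<forall>x\<in>{0<..<1}. m \<le> K x \<and> K x \<le> M))"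

definition three_piece :: "real \<Rightarrow> real \<Rightarrow> real \<Rightarrow> real \<Rightarrow> real \<Rightarrow> real \<Rightarrow> real" where
  "three_piece a b k1 k2 k3 x = (if x < a then k1 else if x < b then k2 else k3)"

text \<open>
  \<open>K\<close> is smooth, differs from the step function only within distance \<open>\<delta>\<close> of its jumps, and does
  not leave the range spanned by the three values of the step function.
\<close>

definition smooth_modification ::
  "real \<Rightarrow> real \<Rightarrow> real \<Rightarrow> real \<Rightarrow> real \<Rightarrow> real \<Rightarrow> (real \<Rightarrow> real) \<Rightarrow> bool" where
  "smooth_modification \<delta> a b k1 k2 k3 K \<longleftrightarrow>
     smooth_on {0<..<1} K \<and>
     (\<forall>x\<in>{0<..<1}. \<bar>x - a\<bar> \<ge> \<delta> \<and> \<bar>x - b\<bar> \<ge> \<delta> \<longrightarrow> K x = three_piece a b k1 k2 k3 x) \<and>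
     (\<forall>x\<in>{0<..<1}. Min {k1, k2, k3} \<le> K x \<and> K x \<le> Max {k1, k2, k3})"

end

theory Submission
  imports Defs
begin

text \<open>
  The flux \<open>F = \<theta> I\<^sup>l Dw + (1 - \<theta>) I\<^sup>r Dw\<close> depends on \<open>Dw\<close> nonlocally, so its sign at a point need
  not be that of \<open>Dw\<close> there. If \<open>F * Dw\<close> is negative on an interval, then a diffusivity that is large
  on a part of that interval and \<open>1\<close> elsewhere makes \<open>B(w,w) = \<integral> K * F * Dw\<close> negative. The
  diffusivity is a step function with three pieces, or the same with the jumps smoothed outwards
  inside the interval (\<open>L2_form_negative_for_large_contrast\<close>).

  Such a \<open>w\<close> is built from bumps (\<open>test_function_with_adverse_flux\<close>). A nonnegative bump \<open>u\<close> to the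
  left of \<open>x\<close> has \<open>I\<^sup>l Du (x) < 0\<close>: its increase and its decrease have equal mass, but the decrease
  is nearer to \<open>x\<close>, where the kernel is larger (\<open>frac_int_left_deriv_le\<close>). By reflection, the negative
  of a bump to the right of \<open>x\<close> has \<open>I\<^sup>r\<close> of its derivative negative at \<open>x\<close>. With
  \<open>N (u(x) - u(1 - x))\<close> for large \<open>N\<close>, the flux between the two bumps is as negative as desired,
  for every \<open>\<theta>\<close> in \<open>[0,1]\<close>, although the derivative vanishes there. A third, fixed bump in
  between makes the derivative positive on some interval without changing the sign of the flux.

  This \<open>w\<close> is a test function, so it lies in every \<open>H\<^sub>0\<close> and its derivative is continuous; the form
  is then an ordinary integral (\<open>test_function_B_value\<close>).
\<close>

section \<open>Smooth functions and bumps\<close>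

text \<open>
  Smoothness, stated through iterated \<^const>\<open>deriv\<close>, is awkward for calculations, since iterated
  derivatives of products and quotients have no simple form. It is enough to exhibit a class of
  functions that is closed under differentiation, and such classes are easy to find.
\<close>

lemma smooth_on_UNIV_coinduct:
  assumes "P f"
    and step: "\<And>f. P f \<Longrightarrow> \<exists>f'. P f' \<and> (\<forall>x. (f has_real_derivative f' x) (at x))"
  shows "smooth_on UNIV f"
proof -
  have deriv_P: "P (deriv h) \<and> (\<forall>x. h differentiable (at x))" if h: "P h" for h
  proof -
    obtain h' where h': "P h'" "\<And>x. (h has_real_derivative h' x) (at x)"
      using step[OF h] by blast
    then have "deriv h = h'"
      by (intro ext DERIV_imp_deriv)
    with h' show ?thesis
      by (auto simp: real_differentiable_def)
  qed
  have "P ((deriv ^^ n) f)" for n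
    by (induction n) (use \<open>P f\<close> deriv_P in auto)
  then show ?thesis
    using deriv_P by (auto simp: smooth_on_def)
qed

lemma smooth_on_subset: "smooth_on T f \<Longrightarrow> S \<subseteq> T \<Longrightarrow> smooth_on S f"
  by (auto simp: smooth_on_def)

lemma smooth_on_deriv: "smooth_on S f \<Longrightarrow> smooth_on S (deriv f)"
  unfolding smooth_on_def by (metis funpow_Suc_right o_apply)

lemma smooth_has_real_derivative:
  "smooth_on UNIV f \<Longrightarrow> (f has_real_derivative deriv f x) (at x)"
  unfolding smooth_on_def DERIV_deriv_iff_real_differentiable
  by (metis UNIV_I funpow_0)

lemma smooth_continuous: "smooth_on UNIV f \<Longrightarrow> continuous_on S f"
  by (meson DERIV_isCont continuous_at_imp_continuous_on smooth_has_real_derivative)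

lemma smooth_const: "smooth_on UNIV (\<lambda>x. c)"
proof (rule smooth_on_UNIV_coinduct[where P = "\<lambda>f. \<exists>c. f = (\<lambda>x. c)"])
  fix f :: "real \<Rightarrow> real" assume "\<exists>c. f = (\<lambda>x. c)"
  then show "\<exists>f'. (\<exists>c. f' = (\<lambda>x. c)) \<and> (\<forall>x. (f has_real_derivative f' x) (at x))"
    by (intro exI[of _ "\<lambda>x. 0"]) auto
qed auto

lemma smooth_affine:
  assumes "smooth_on UNIV f"
  shows "smooth_on UNIV (\<lambda>x. f (c * x + d))"
proof (rule smooth_on_UNIV_coinduct[where
      P = "\<lambda>g. \<exists>k h. smooth_on UNIV h \<and> g = (\<lambda>x. k * h (c * x + d))"])
  show "\<exists>k h. smooth_on UNIV h \<and> (\<lambda>x. f (c * x + d)) = (\<lambda>x. k * h (c * x + d))"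
    using assms by (intro exI[of _ 1] exI[of _ f]) auto
next
  fix g assume "\<exists>k h. smooth_on UNIV h \<and> g = (\<lambda>x. k * h (c * x + d))"
  then obtain k h where h: "smooth_on UNIV h" "g = (\<lambda>x. k * h (c * x + d))"
    by blast
  have "(g has_real_derivative (k * c) * deriv h (c * x + d)) (at x)" for x
  proof -
    have "((\<lambda>x. h (c * x + d)) has_real_derivative deriv h (c * x + d) * c) (at x)"
      by (rule DERIV_chain2[OF smooth_has_real_derivative[OF h(1)]])
        (auto intro!: derivative_eq_intros)
    from DERIV_cmult[OF this, of k] show ?thesis
      using h(2) by (simp add: algebra_simps)
  qed
  then show "\<exists>g'. (\<exists>k h. smooth_on UNIV h \<and> g' = (\<lambda>x. k * h (c * x + d))) \<and>
      (\<forall>x. (g has_real_derivative g' x) (at x))"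
    using smooth_on_deriv[OF h(1)]
    by (intro exI[of _ "\<lambda>x. (k * c) * deriv h (c * x + d)"]) blast
qed

lemma smooth_add:
  assumes "smooth_on UNIV f" "smooth_on UNIV g"
  shows "smooth_on UNIV (\<lambda>x. f x + g x)"
proof (rule smooth_on_UNIV_coinduct[where
      P = "\<lambda>h. \<exists>f g. smooth_on UNIV f \<and> smooth_on UNIV g \<and> h = (\<lambda>x. f x + g x)"])
  fix h assume "\<exists>f g. smooth_on UNIV f \<and> smooth_on UNIV g \<and> h = (\<lambda>x. f x + g x)"
  then obtain f g where fg: "smooth_on UNIV f" "smooth_on UNIV g" "h = (\<lambda>x. f x + g x)"
    by blast
  have "(h has_real_derivative deriv f x + deriv g x) (at x)" for x
    unfolding fg(3) by (intro DERIV_add smooth_has_real_derivative fg)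
  then show "\<exists>h'. (\<exists>f g. smooth_on UNIV f \<and> smooth_on UNIV g \<and> h' = (\<lambda>x. f x + g x)) \<and>
      (\<forall>x. (h has_real_derivative h' x) (at x))"
    using smooth_on_deriv[OF fg(1)] smooth_on_deriv[OF fg(2)]
    by (intro exI[of _ "\<lambda>x. deriv f x + deriv g x"]) blast
qed (use assms in blast)

text \<open>
  Products of smooth functions are not closed under differentiation, but by the Leibniz rule their
  finite sums are.
\<close>

inductive sum_of_smooth_products :: "(real \<Rightarrow> real) \<Rightarrow> bool" where
  product: "smooth_on UNIV f \<Longrightarrow> smooth_on UNIV g \<Longrightarrow> sum_of_smooth_products (\<lambda>x. f x * g x)"
| sum: "sum_of_smooth_products f \<Longrightarrow> sum_of_smooth_products g \<Longrightarrow>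
    sum_of_smooth_products (\<lambda>x. f x + g x)"

lemma smooth_mult:
  assumes "smooth_on UNIV f" "smooth_on UNIV g"
  shows "smooth_on UNIV (\<lambda>x. f x * g x)"
proof (rule smooth_on_UNIV_coinduct[where P = sum_of_smooth_products])
  fix h assume "sum_of_smooth_products h"
  then show "\<exists>h'. sum_of_smooth_products h' \<and> (\<forall>x. (h has_real_derivative h' x) (at x))"
  proof induction
    case (product f g)
    have "((\<lambda>x. f x * g x) has_real_derivative deriv f x * g x + deriv g x * f x) (at x)" for x
      by (intro DERIV_mult smooth_has_real_derivative product)
    moreover have "sum_of_smooth_products (\<lambda>x. deriv f x * g x + deriv g x * f x)"
      using product by (intro sum_of_smooth_products.intros smooth_on_deriv)
    ultimately show ?case by blast
  next
    case (sum f g)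
    then obtain f' g' where "sum_of_smooth_products f'" "sum_of_smooth_products g'"
      and d: "\<And>x. (f has_real_derivative f' x) (at x)" "\<And>x. (g has_real_derivative g' x) (at x)"
      by blast
    then have "sum_of_smooth_products (\<lambda>x. f' x + g' x)"
      by (intro sum_of_smooth_products.sum)
    moreover have "((\<lambda>x. f x + g x) has_real_derivative f' x + g' x) (at x)" for x
      by (intro DERIV_add d)
    ultimately show ?case by blast
  qed
qed (use assms in \<open>rule sum_of_smooth_products.product\<close>)

lemma smooth_divide:
  assumes f: "smooth_on UNIV f" and g: "smooth_on UNIV g" and "\<And>x. g x \<noteq> 0"
  shows "smooth_on UNIV (\<lambda>x. f x / g x)"
proof (rule smooth_on_UNIV_coinduct[where
      P = "\<lambda>h. \<exists>s n. smooth_on UNIV s \<and> h = (\<lambda>x. s x / g x ^ n)"])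
  show "\<exists>s n. smooth_on UNIV s \<and> (\<lambda>x. f x / g x) = (\<lambda>x. s x / g x ^ n)"
    using f by (intro exI[of _ f] exI[of _ 1]) auto
next
  fix h assume "\<exists>s n. smooth_on UNIV s \<and> h = (\<lambda>x. s x / g x ^ n)"
  then obtain s n where s: "smooth_on UNIV s" and h: "h = (\<lambda>x. s x / g x ^ n)"
    by blast
  \<comment> \<open>The class of all \<open>s / g ^ n\<close> is closed under differentiation; this is the next numerator.\<close>
  define s' where "s' = (\<lambda>x. deriv s x * g x + ((- real n) * s x) * deriv g x)"
  have "smooth_on UNIV s'"
    unfolding s'_def
    by (intro smooth_add smooth_mult smooth_const smooth_on_deriv s g)
  moreover have "(h has_real_derivative s' x / g x ^ Suc n) (at x)" for x
    unfolding h
    using assms(3)[of x] smooth_has_real_derivative[OF s, of x] smooth_has_real_derivative[OF g, of x]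
    by (auto intro!: derivative_eq_intros simp: s'_def field_simps)
      (cases n; simp add: field_simps)
  ultimately show "\<exists>h'. (\<exists>s n. smooth_on UNIV s \<and> h' = (\<lambda>x. s x / g x ^ n)) \<and>
      (\<forall>x. (h has_real_derivative h' x) (at x))"
    by blast
qed

text \<open>
  The classical smooth function that vanishes exactly on the left half line is \<open>exp (- 1 / x)\<close>, here
  with a polynomial factor in \<open>1 / x\<close> so that the family is closed under differentiation.
\<close>

definition flat_exp :: "real poly \<Rightarrow> real \<Rightarrow> real" where
  "flat_exp p x = (if x \<le> 0 then 0 else poly p (1 / x) * exp (- (1 / x)))"

lemma poly_times_exp_minus_tendsto_0: "((\<lambda>y::real. poly p y * exp (- y)) \<longlongrightarrow> 0) at_top"
proof -
  have "((\<lambda>y::real. \<Sum>i\<le>degree p. coeff p i * (y ^ i / exp y)) \<longlongrightarrow> 0) at_top"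
    by (intro tendsto_null_sum tendsto_mult_right_zero tendsto_power_div_exp_0)
  then show ?thesis
    by (simp add: poly_altdef sum_distrib_right sum_divide_distrib exp_minus field_simps)
qed

text \<open>
  Away from \<open>0\<close> this is the chain rule with \<open>y = 1 / x\<close>, whose derivative is \<open>- y\<^sup>2\<close>. At \<open>0\<close> the
  difference quotient is \<open>y * poly p y * exp (- y)\<close>, and \<open>y\<close> tends to infinity.
\<close>

lemma flat_exp_has_derivative:
  "(flat_exp p has_real_derivative flat_exp ((p - pderiv p) * [:0, 0, 1:]) x) (at x)"
proof -
  let ?p' = "(p - pderiv p) * [:0, 0, 1:]"
  consider "x < 0" | "x > 0" | "x = 0" by linarith
  then show ?thesis
  proof cases
    case 1
    have "((\<lambda>_. 0) has_real_derivative flat_exp ?p' x) (at x)"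
      using 1 by (simp add: flat_exp_def)
    then show ?thesis
      by (rule has_field_derivative_transform_within_open[of _ _ _ "{..<0}"])
        (use 1 in \<open>auto simp: flat_exp_def\<close>)
  next
    case 2
    have "((\<lambda>x. poly p (1 / x) * exp (- (1 / x))) has_real_derivative flat_exp ?p' x) (at x)"
      using 2
      by (auto intro!: derivative_eq_intros DERIV_chain2[OF poly_DERIV]
          simp: flat_exp_def field_simps power2_eq_square)
    then show ?thesis
      by (rule has_field_derivative_transform_within_open[of _ _ _ "{0<..}"])
        (use 2 in \<open>auto simp: flat_exp_def\<close>)
  next
    case 3
    have "((\<lambda>h. poly ([:0, 1:] * p) (inverse h) * exp (- inverse h)) \<longlongrightarrow> 0) (at_right 0)"
      using filterlim_compose[OF poly_times_exp_minus_tendsto_0 filterlim_inverse_at_top_right] .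
    then have "((\<lambda>h. (flat_exp p (0 + h) - flat_exp p 0) / h) \<longlongrightarrow> 0) (at_right 0)"
      by (rule Lim_transform_eventually)
        (auto simp: flat_exp_def eventually_at_filter field_simps)
    moreover have "((\<lambda>h. (flat_exp p (0 + h) - flat_exp p 0) / h) \<longlongrightarrow> 0) (at_left 0)"
      by (rule Lim_transform_eventually[OF tendsto_const])
        (auto simp: flat_exp_def eventually_at_filter)
    ultimately show ?thesis
      using 3 by (simp add: DERIV_def filterlim_at_split flat_exp_def)
  qed
qed

lemma smooth_flat_exp: "smooth_on UNIV (flat_exp p)"
  by (rule smooth_on_UNIV_coinduct[where P = "\<lambda>f. \<exists>p. f = flat_exp p"])
    (use flat_exp_has_derivative in blast)+

lemma smooth_bump:
  obtains \<eta> :: "real \<Rightarrow> real"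
  where "smooth_on UNIV \<eta>" "\<And>x. 0 \<le> \<eta> x" "\<And>x. \<eta> x > 0 \<longleftrightarrow> x \<in> {0<..<1}"
proof
  let ?\<eta> = "\<lambda>x. flat_exp 1 x * flat_exp 1 ((-1) * x + 1)"
  show "smooth_on UNIV ?\<eta>"
    by (intro smooth_mult smooth_affine smooth_flat_exp)
  show "0 \<le> ?\<eta> x" "?\<eta> x > 0 \<longleftrightarrow> x \<in> {0<..<1}" for x
    by (auto simp: flat_exp_def)
qed

lemma smooth_step:
  obtains T :: "real \<Rightarrow> real"
  where "smooth_on UNIV T" "\<And>x. 0 \<le> T x" "\<And>x. T x \<le> 1"
    "\<And>x. x \<le> 0 \<Longrightarrow> T x = 0" "\<And>x. 1 \<le> x \<Longrightarrow> T x = 1"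
proof
  let ?f = "flat_exp 1" and ?g = "\<lambda>x. flat_exp 1 ((-1) * x + 1)"
  \<comment> \<open>One of \<open>x\<close> and \<open>1 - x\<close> is positive, so the denominator never vanishes.\<close>
  let ?T = "\<lambda>x. ?f x / (?f x + ?g x)"
  have nonneg: "?f x \<ge> 0" "?g x \<ge> 0" and pos: "?f x + ?g x > 0" for x
    by (auto simp: flat_exp_def add_pos_pos)
  show "smooth_on UNIV ?T"
    using pos by (intro smooth_divide smooth_add smooth_affine smooth_flat_exp) (metis less_irrefl)
  show "0 \<le> ?T x" "?T x \<le> 1" for x
    using nonneg[of x] pos[of x] by (auto simp: divide_simps)
  show "x \<le> 0 \<Longrightarrow> ?T x = 0" "1 \<le> x \<Longrightarrow> ?T x = 1" for x
    by (auto simp: flat_exp_def)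
qed

lemma smooth_plateau:
  assumes "\<epsilon> > 0"
  obtains S :: "real \<Rightarrow> real"
  where "smooth_on UNIV S" "\<And>x. 0 \<le> S x" "\<And>x. S x \<le> 1"
    "\<And>x. a \<le> x \<Longrightarrow> x \<le> b \<Longrightarrow> S x = 1"
    "\<And>x. x \<le> a - \<epsilon> \<Longrightarrow> S x = 0" "\<And>x. b + \<epsilon> \<le> x \<Longrightarrow> S x = 0"
proof -
  obtain T where T: "smooth_on UNIV T" "\<And>x. 0 \<le> T x" "\<And>x. T x \<le> 1"
    "\<And>x. x \<le> 0 \<Longrightarrow> T x = 0" "\<And>x. 1 \<le> x \<Longrightarrow> T x = 1"
    using smooth_step by blast
  let ?S = "\<lambda>x. T (1 / \<epsilon> * x + (1 - a / \<epsilon>)) * T ((- 1 / \<epsilon>) * x + (1 + b / \<epsilon>))"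
  show ?thesis
  proof (rule that[of ?S])
    show "smooth_on UNIV ?S"
      by (intro smooth_mult smooth_affine T)
    show "0 \<le> ?S x" "?S x \<le> 1" for x
      using T(2,3) by (auto intro: mult_le_one)
    show "?S x = 1" if "a \<le> x" "x \<le> b" for x
      using that \<open>\<epsilon> > 0\<close> by (subst (1 2) T(5)) (auto simp: field_simps)
    show "?S x = 0" if "x \<le> a - \<epsilon>" for x
      using that \<open>\<epsilon> > 0\<close> by (subst T(4)) (auto simp: field_simps)
    show "?S x = 0" if "b + \<epsilon> \<le> x" for x
    proof -
      have "T ((- 1 / \<epsilon>) * x + (1 + b / \<epsilon>)) = 0"
        using mult_left_mono[OF that, of \<epsilon>] \<open>\<epsilon> > 0\<close>
        by (intro T(4)) (auto simp: field_simps)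
      then show ?thesis by simp
    qed
  qed
qed

lemma deriv_eq_0_outside:
  fixes u :: "real \<Rightarrow> real"
  assumes "\<And>s. s \<notin> {p..q} \<Longrightarrow> u s = 0" "s \<notin> {p..q}"
  shows "deriv u s = 0"
proof (rule DERIV_imp_deriv)
  show "(u has_real_derivative 0) (at s)"
    by (rule has_field_derivative_transform_within_open[of "\<lambda>_. 0" _ _ "- {p..q}"])
      (use assms in auto)
qed

lemma bounded_range_compact_support:
  fixes g :: "real \<Rightarrow> real"
  assumes "continuous_on UNIV g" "\<And>s. s \<notin> {p..q} \<Longrightarrow> g s = 0"
  shows "bounded (range g)"
proof (rule bounded_subset)
  show "bounded (insert 0 (g ` {p..q}))"
    using assms(1)
    by (auto intro!: compact_imp_bounded compact_continuous_image intro: continuous_on_subset)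
  show "range g \<subseteq> insert 0 (g ` {p..q})"
    using assms(2) by blast
qed

section \<open>Fractional integrals and the flux\<close>

lemma set_integrable_bounded_real:
  fixes f :: "real \<Rightarrow> real"
  assumes "set_borel_measurable lborel A f" "A \<in> sets lborel" "emeasure lborel A < \<infinity>"
    and "\<And>x. x \<in> A \<Longrightarrow> \<bar>f x\<bar> \<le> C"
  shows "set_integrable lborel A f"
  unfolding set_integrable_def
  by (rule integrableI_bounded_set[where A = A and B = C])
    (use assms in \<open>auto simp: set_borel_measurable_def\<close>)

text \<open>
  A nonpositive integrand with integral zero would vanish almost everywhere, but the interval has
  positive measure.
\<close>

lemma set_integral_less_0:
  fixes f :: "real \<Rightarrow> real"
  assumes f: "set_integrable lborel A f" and "a < b" "{a<..<b} \<subseteq> A"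
    and le: "\<And>x. x \<in> A \<Longrightarrow> f x \<le> 0" and less: "\<And>x. x \<in> {a<..<b} \<Longrightarrow> f x < 0"
  shows "(LINT x:A|lborel. f x) < 0"
proof -
  let ?h = "\<lambda>x. - (indicator A x *\<^sub>R f x)"
  have h_int: "integrable lborel ?h" and h_nonneg: "0 \<le> ?h x" for x
    using f le by (auto simp: set_integrable_def indicator_def)
  have "(LINT x|lborel. ?h x) \<noteq> 0"
  proof
    assume "(LINT x|lborel. ?h x) = 0"
    then have "AE x in lborel. ?h x = 0"
      using integral_nonneg_eq_0_iff_AE[OF h_int] h_nonneg by blast
    moreover have "?h x \<noteq> 0" if "x \<in> {a<..<b}" for x
      using that assms(3) less[OF that] by auto
    ultimately have "AE x in lborel. x \<notin> {a<..<b}"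
      by (auto elim: eventually_mono)
    then have "{a<..<b} \<in> null_sets lborel"
      by (subst AE_iff_null_sets) auto
    then show False
      using \<open>a < b\<close> by (simp add: null_sets_def)
  qed
  moreover have "(LINT x|lborel. ?h x) \<ge> 0"
    by (rule Bochner_Integration.integral_nonneg) (rule h_nonneg)
  ultimately show ?thesis
    by (simp add: set_lebesgue_integral_def)
qed

text \<open>
  The kernel is singular at the right end point, so its integral is computed from the primitive
  \<open>- (x - s) powr \<beta> / \<beta>\<close>, which is continuous up to that point because \<open>\<beta>\<close> is positive.
\<close>

lemma abel_kernel:
  fixes \<beta> x :: real
  assumes "0 < \<beta>" "0 < x"
  shows "set_integrable lborel {0<..<x} (\<lambda>s. 1 / (x - s) powr (1 - \<beta>))"
    and "(LINT s:{0<..<x}|lborel. 1 / (x - s) powr (1 - \<beta>)) = x powr \<beta> / \<beta>"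
proof -
  let ?F = "\<lambda>s. - ((x - s) powr \<beta>) / \<beta>" and ?f = "\<lambda>s. 1 / (x - s) powr (1 - \<beta>)"
  have deriv: "(?F has_real_derivative ?f s) (at s)" if "ereal s < ereal x" for s
  proof -
    have "((\<lambda>s. (x - s) powr \<beta>) has_real_derivative \<beta> * (x - s) powr (\<beta> - 1) * (- 1)) (at s)"
      by (rule DERIV_chain2[OF has_real_derivative_powr])
        (use that in \<open>auto intro!: derivative_eq_intros\<close>)
    from DERIV_cmult[OF this, of "- 1 / \<beta>"] show ?thesis
      using \<open>0 < \<beta>\<close> powr_minus_divide[of "x - s" "1 - \<beta>"] by simp
  qed
  have cont: "isCont ?f s" if "ereal s < ereal x" for s
    using that by (auto intro!: continuous_intros)
  have "(?F \<longlongrightarrow> - ((x - 0) powr \<beta>) / \<beta>) (at_right 0)"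
    using assms by (intro tendsto_intros) auto
  then have A: "((?F \<circ> real_of_ereal) \<longlongrightarrow> - (x powr \<beta>) / \<beta>) (at_right (ereal 0))"
    by (simp add: ereal_tendsto_simps)
  have "(?F \<longlongrightarrow> - ((x - x) powr \<beta>) / \<beta>) (at_left x)"
    using assms by (intro tendsto_intros tendsto_powr') (auto simp: eventually_at_filter)
  then have B: "((?F \<circ> real_of_ereal) \<longlongrightarrow> 0) (at_left (ereal x))"
    by (simp add: ereal_tendsto_simps)
  note FTC = interval_integral_FTC_nonneg[of "ereal 0" "ereal x" ?F ?f, OF _ deriv cont _ A B]
  show "set_integrable lborel {0<..<x} ?f"
    using FTC(1) assms by simp
  show "(LINT s:{0<..<x}|lborel. ?f s) = x powr \<beta> / \<beta>"
    using FTC(2) assms by (simp add: interval_integral_eq_integral' interval_lebesgue_integral_def)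
qed

lemma frac_int_left_integrable:
  fixes g :: "real \<Rightarrow> real"
  assumes "0 < \<beta>" "g \<in> borel_measurable borel" "bounded (range g)"
  shows "set_integrable lborel {0<..<x} (\<lambda>s. g s / (x - s) powr (1 - \<beta>))"
proof (cases "0 < x")
  case True
  obtain M where M: "\<And>s. \<bar>g s\<bar> \<le> M"
    using assms(3) by (auto simp: bounded_iff)
  show ?thesis
  proof (rule set_integrable_bound)
    show "set_integrable lborel {0<..<x} (\<lambda>s. M * (1 / (x - s) powr (1 - \<beta>)))"
      using abel_kernel(1)[OF assms(1) True] by (rule set_integrable_mult_right)
    show "set_borel_measurable lborel {0<..<x} (\<lambda>s. g s / (x - s) powr (1 - \<beta>))"
      using assms(2) by (simp add: set_borel_measurable_def)
    show "AE s in lborel. s \<in> {0<..<x} \<longrightarrow>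
        norm (g s / (x - s) powr (1 - \<beta>)) \<le> norm (M * (1 / (x - s) powr (1 - \<beta>)))"
      using M by (auto simp: divide_right_mono abs_mult order_trans[OF M abs_ge_self])
  qed
qed auto

lemma frac_int_left_bounded:
  assumes "0 < \<beta>" "g \<in> borel_measurable borel" "bounded (range g)"
  obtains C where "\<And>x. x \<in> {0<..<1} \<Longrightarrow> \<bar>frac_int_left \<beta> g x\<bar> \<le> C"
proof -
  obtain M where M: "\<And>s. \<bar>g s\<bar> \<le> M"
    using assms(3) by (auto simp: bounded_iff)
  have "\<bar>frac_int_left \<beta> g x\<bar> \<le> 1 / Gamma \<beta> * (M * (1 / \<beta>))" if x: "x \<in> {0<..<1}" for x
  proof -
    have "\<bar>LINT s:{0<..<x}|lborel. g s / (x - s) powr (1 - \<beta>)\<bar>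
        \<le> (LINT s:{0<..<x}|lborel. \<bar>g s / (x - s) powr (1 - \<beta>)\<bar>)"
      using set_integral_norm_bound[OF frac_int_left_integrable[OF assms, of x]] by simp
    also have "\<dots> \<le> (LINT s:{0<..<x}|lborel. M * (1 / (x - s) powr (1 - \<beta>)))"
      using abel_kernel(1)[OF assms(1)] x M
      by (intro set_integral_mono set_integrable_abs frac_int_left_integrable assms
          set_integrable_mult_right) (auto simp: divide_right_mono)
    also have "\<dots> = M * (x powr \<beta> / \<beta>)"
      unfolding set_integral_mult_right using abel_kernel(2)[OF assms(1), of x] x by simp
    also have "\<dots> \<le> M * (1 / \<beta>)"
      using x assms(1) order_trans[OF abs_ge_zero M]
      by (intro mult_left_mono divide_right_mono) (auto simp: powr_le1)
    finally show ?thesis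
      using Gamma_real_pos[OF assms(1)]
      by (simp add: frac_int_left_def abs_mult divide_right_mono field_simps)
  qed
  then show ?thesis by (rule that)
qed

lemma frac_int_left_linear:
  assumes "0 < \<beta>" "f \<in> borel_measurable borel" "bounded (range f)"
    "g \<in> borel_measurable borel" "bounded (range g)"
  shows "frac_int_left \<beta> (\<lambda>s. c * f s + g s) x = c * frac_int_left \<beta> f x + frac_int_left \<beta> g x"
proof -
  have "(LINT s:{0<..<x}|lborel. (c * f s + g s) / (x - s) powr (1 - \<beta>)) =
      (LINT s:{0<..<x}|lborel. c * (f s / (x - s) powr (1 - \<beta>)) + g s / (x - s) powr (1 - \<beta>))"
    by (simp add: add_divide_distrib)
  also have "\<dots> = c * (LINT s:{0<..<x}|lborel. f s / (x - s) powr (1 - \<beta>)) +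
      (LINT s:{0<..<x}|lborel. g s / (x - s) powr (1 - \<beta>))"
    using set_integral_add(2)[OF set_integrable_mult_right frac_int_left_integrable[OF assms(1,4,5)],
        OF frac_int_left_integrable[OF assms(1,2,3)], of x c]
    unfolding set_integral_mult_right .
  finally show ?thesis
    by (simp add: frac_int_left_def algebra_simps add_divide_distrib)
qed

lemma frac_int_left_measurable:
  assumes [measurable]: "g \<in> borel_measurable borel"
  shows "frac_int_left \<beta> g \<in> borel_measurable borel"
proof -
  have "(\<lambda>x. LINT s|lborel. (if 0 < s \<and> s < x then g s / (x - s) powr (1 - \<beta>) else 0))
      \<in> borel_measurable borel"
    by measurable
  moreover have "(LINT s|lborel. (if 0 < s \<and> s < x then g s / (x - s) powr (1 - \<beta>) else 0)) =
      (LINT s:{0<..<x}|lborel. g s / (x - s) powr (1 - \<beta>))" for x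
    unfolding set_lebesgue_integral_def by (intro Bochner_Integration.integral_cong) auto
  ultimately show ?thesis
    by (simp add: frac_int_left_def[abs_def])
qed

lemma frac_int_left_cong:
  assumes "\<And>s. 0 < s \<Longrightarrow> s < x \<Longrightarrow> f s = g s"
  shows "frac_int_left \<beta> f x = frac_int_left \<beta> g x"
  unfolding frac_int_left_def
  using assms by (intro arg_cong2[where f = "(*)"] set_lebesgue_integral_cong) auto

text \<open>
  The reflection \<open>s \<mapsto> 1 - s\<close> exchanges the two fractional integrals, so only the left one needs to
  be estimated.
\<close>

lemma frac_int_right_reflect:
  "frac_int_right \<beta> g x = frac_int_left \<beta> (\<lambda>s. g (1 - s)) (1 - x)"
proof -
  have "(LINT s:{x<..<1}|lborel. g s / (s - x) powr (1 - \<beta>)) =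
      (LINT s:{0<..<1 - x}|lborel. g (1 - s) / (1 - x - s) powr (1 - \<beta>))"
    unfolding set_lebesgue_integral_def
    by (subst lborel_integral_real_affine[where c = "- 1" and t = 1])
      (auto intro!: Bochner_Integration.integral_cong simp: indicator_def algebra_simps)
  then show ?thesis
    by (simp add: frac_int_right_def frac_int_left_def)
qed

text \<open>
  The fractional flux without the diffusivity: for \<open>g = Dw\<close> the form is the integral of
  \<open>K * flux \<beta> \<theta> g * g\<close>.
\<close>

definition flux :: "real \<Rightarrow> real \<Rightarrow> (real \<Rightarrow> real) \<Rightarrow> real \<Rightarrow> real" where
  "flux \<beta> \<theta> g x = \<theta> * frac_int_left \<beta> g x + (1 - \<theta>) * frac_int_right \<beta> g x"

lemma reflect_measurable_bounded:
  fixes g :: "real \<Rightarrow> real"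
  assumes "g \<in> borel_measurable borel" "bounded (range g)"
  shows "(\<lambda>s. g (1 - s)) \<in> borel_measurable borel" "bounded (range (\<lambda>s. g (1 - s)))"
proof -
  show "(\<lambda>s. g (1 - s)) \<in> borel_measurable borel"
    by (rule measurable_compose[OF _ assms(1)]) simp
  show "bounded (range (\<lambda>s. g (1 - s)))"
    by (rule bounded_subset[OF assms(2)]) auto
qed

lemma frac_int_right_bounded:
  assumes "0 < \<beta>" "g \<in> borel_measurable borel" "bounded (range g)"
  obtains C where "\<And>x. x \<in> {0<..<1} \<Longrightarrow> \<bar>frac_int_right \<beta> g x\<bar> \<le> C"
  using frac_int_left_bounded[OF assms(1) reflect_measurable_bounded[OF assms(2,3)]]
  by (metis (no_types, lifting) frac_int_right_reflect diff_gt_0_iff_gt diff_less_eq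
      greaterThanLessThan_iff less_add_same_cancel1)

lemma frac_int_right_measurable:
  assumes "g \<in> borel_measurable borel"
  shows "frac_int_right \<beta> g \<in> borel_measurable borel"
  unfolding frac_int_right_reflect[abs_def]
  by (intro measurable_compose[OF _ frac_int_left_measurable]
      measurable_compose[OF _ assms]) simp_all

lemma flux_bounded:
  assumes "0 < \<beta>" "g \<in> borel_measurable borel" "bounded (range g)"
  obtains C where "\<And>x. x \<in> {0<..<1} \<Longrightarrow> \<bar>flux \<beta> \<theta> g x\<bar> \<le> C"
proof -
  obtain C1 C2 where C: "\<And>x. x \<in> {0<..<1} \<Longrightarrow> \<bar>frac_int_left \<beta> g x\<bar> \<le> C1"
      "\<And>x. x \<in> {0<..<1} \<Longrightarrow> \<bar>frac_int_right \<beta> g x\<bar> \<le> C2"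
    using frac_int_left_bounded[OF assms] frac_int_right_bounded[OF assms] by metis
  show ?thesis
  proof (rule that)
    fix x :: real assume x: "x \<in> {0<..<1}"
    have "\<bar>flux \<beta> \<theta> g x\<bar> \<le> \<bar>\<theta>\<bar> * \<bar>frac_int_left \<beta> g x\<bar> + \<bar>1 - \<theta>\<bar> * \<bar>frac_int_right \<beta> g x\<bar>"
      unfolding flux_def abs_mult[symmetric] by (rule abs_triangle_ineq)
    also have "\<dots> \<le> \<bar>\<theta>\<bar> * C1 + \<bar>1 - \<theta>\<bar> * C2"
      using C[OF x] by (intro add_mono mult_left_mono) auto
    finally show "\<bar>flux \<beta> \<theta> g x\<bar> \<le> \<bar>\<theta>\<bar> * C1 + \<bar>1 - \<theta>\<bar> * C2" .
  qed
qed

lemma flux_linear: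
  assumes "0 < \<beta>" "f \<in> borel_measurable borel" "bounded (range f)"
    "g \<in> borel_measurable borel" "bounded (range g)"
  shows "flux \<beta> \<theta> (\<lambda>s. c * f s + g s) x = c * flux \<beta> \<theta> f x + flux \<beta> \<theta> g x"
  using frac_int_left_linear[OF assms] frac_int_left_linear[OF assms(1)
      reflect_measurable_bounded[OF assms(2,3)] reflect_measurable_bounded[OF assms(4,5)]]
  by (simp add: flux_def frac_int_right_reflect algebra_simps)

text \<open>
  Both fractional integrals are bounded, so the two pairings can be joined into one integral. Its
  dependence on \<open>K\<close> is then a pointwise matter.
\<close>

lemma L2_form_eq_flux:
  assumes "0 < \<beta>" "g \<in> borel_measurable borel" "bounded (range g)"
    and K: "K \<in> borel_measurable borel" "\<And>x. x \<in> {0<..<1} \<Longrightarrow> \<bar>K x\<bar> \<le> M"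
  shows "L2_form K \<beta> \<theta> g g = (LINT x:{0<..<1}|lborel. K x * (flux \<beta> \<theta> g x * g x))"
    and "set_integrable lborel {0<..<1} (\<lambda>x. K x * (flux \<beta> \<theta> g x * g x))"
proof -
  obtain D where D: "\<And>s. \<bar>g s\<bar> \<le> D"
    using assms(3) by (auto simp: bounded_iff)
  obtain C1 C2 where C: "\<And>x. x \<in> {0<..<1} \<Longrightarrow> \<bar>frac_int_left \<beta> g x\<bar> \<le> C1"
      "\<And>x. x \<in> {0<..<1} \<Longrightarrow> \<bar>frac_int_right \<beta> g x\<bar> \<le> C2"
    using frac_int_left_bounded[OF assms(1-3)] frac_int_right_bounded[OF assms(1-3)] by metis
  have integrable: "set_integrable lborel {0<..<1} (\<lambda>x. K x * F x * g x)"
    if "F \<in> borel_measurable borel" "\<And>x. x \<in> {0<..<1} \<Longrightarrow> \<bar>F x\<bar> \<le> C" for F C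
  proof (rule set_integrable_bounded_real)
    show "set_borel_measurable lborel {0<..<1} (\<lambda>x. K x * F x * g x)"
      using that(1) K(1) assms(2) by (simp add: set_borel_measurable_def)
    show "\<bar>K x * F x * g x\<bar> \<le> M * C * D" if "x \<in> {0<..<1}" for x
      unfolding abs_mult
      using \<open>\<And>x. x \<in> {0<..<1} \<Longrightarrow> \<bar>F x\<bar> \<le> C\<close>[OF that] K(2)[OF that] D[of x]
      by (intro mult_mono) (auto intro: order_trans[OF abs_ge_zero] mult_nonneg_nonneg)
  qed auto
  note int = integrable[OF frac_int_left_measurable C(1), OF assms(2)]
    integrable[OF frac_int_right_measurable C(2), OF assms(2)]
  have eq: "K x * (flux \<beta> \<theta> g x * g x) = \<theta> * (K x * frac_int_left \<beta> g x * g x) +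
      (1 - \<theta>) * (K x * frac_int_right \<beta> g x * g x)" for x
    by (simp add: flux_def algebra_simps)
  show "L2_form K \<beta> \<theta> g g = (LINT x:{0<..<1}|lborel. K x * (flux \<beta> \<theta> g x * g x))"
    unfolding eq L2_form_def using int by (subst set_integral_add) auto
  show "set_integrable lborel {0<..<1} (\<lambda>x. K x * (flux \<beta> \<theta> g x * g x))"
    unfolding eq using int by (intro set_integral_add(1)) auto
qed

section \<open>The form on test functions\<close>

lemma test_function_deriv:
  assumes "test_function w"
  shows "continuous_on UNIV (deriv w)" "bounded (range (deriv w))"
    "\<And>x. x \<notin> {0<..<1} \<Longrightarrow> w x = 0" "\<And>x. x \<notin> {0<..<1} \<Longrightarrow> deriv w x = 0"
proof -
  obtain a b where ab: "0 < a" "b < 1" "\<And>x. x \<notin> {a..b} \<Longrightarrow> w x = 0"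
    using assms by (auto simp: test_function_def)
  have w'_0: "deriv w x = 0" if "x \<notin> {a..b}" for x
    using ab(3) that by (rule deriv_eq_0_outside)
  show cont: "continuous_on UNIV (deriv w)"
    using assms by (auto simp: test_function_def intro: smooth_continuous smooth_on_deriv)
  show "bounded (range (deriv w))"
    using cont w'_0 by (rule bounded_range_compact_support)
  show "w x = 0" "deriv w x = 0" if "x \<notin> {0<..<1}" for x
    using that ab w'_0[of x] by auto
qed

lemma test_function_in_H0:
  assumes "test_function w"
  shows "w \<in> H0 \<mu>"
proof -
  \<comment> \<open>The constant sequence has error zero.\<close>
  have "approximates \<mu> (\<lambda>n. w) w"
    using assms by (simp add: approximates_def sobolev_norm_sq_def fourier_def)
  moreover have "w \<in> borel_measurable lborel"
    using assms
    by (auto simp: test_function_def intro!: borel_measurable_continuous_onI smooth_continuous)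
  ultimately show ?thesis
    using test_function_deriv(3)[OF assms] by (auto simp: H0_def)
qed

lemma test_function_weak_derivative:
  assumes w: "test_function w"
  shows "weak_derivative w (deriv w)"
proof -
  have smooth: "smooth_on UNIV f" if "test_function f" for f
    using that by (simp add: test_function_def)
  have deriv: "(f has_real_derivative deriv f x) (at x)" "isCont (deriv f) x"
    if "test_function f" for f x
    using smooth_has_real_derivative[OF smooth[OF that]] test_function_deriv(1)[OF that]
    by (auto simp: continuous_on_eq_continuous_at)
  have int: "set_integrable lborel {0<..<1} f" if "continuous_on UNIV f" for f :: "real \<Rightarrow> real"
  proof (rule set_integrable_subset)
    show "set_integrable lborel {0..1} f"
      unfolding set_integrable_def
      by (rule borel_integrable_compact) (auto intro: continuous_on_subset[OF that])
  qed auto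
  have "(LINT x:{0<..<1}|lborel. w x * deriv \<phi> x) = - (LINT x:{0<..<1}|lborel. deriv w x * \<phi> x)"
    if \<phi>: "test_function \<phi>" for \<phi>
  proof -
    have closed: "(LINT x:{0<..<1}|lborel. f x) = (LINT x|lborel. indicator {0..1} x *\<^sub>R f x)"
      if "f 0 = 0" "f 1 = 0" for f :: "real \<Rightarrow> real"
      unfolding set_lebesgue_integral_def
      using that
      by (intro Bochner_Integration.integral_cong) (auto simp: indicator_def less_le)
    have "(LINT x|lborel. indicator {0..1} x *\<^sub>R (w x * deriv \<phi> x)) =
        w 1 * \<phi> 1 - w 0 * \<phi> 0 - (LINT x|lborel. indicator {0..1} x *\<^sub>R (deriv w x * \<phi> x))"
      using w \<phi> by (intro integral_by_parts' deriv) auto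
    then show ?thesis
      by (simp add: closed test_function_deriv(3,4)[OF w])
  qed
  then show ?thesis
    unfolding weak_derivative_def
    using int smooth_continuous[OF smooth[OF w]] test_function_deriv(1)[OF w] by blast
qed

lemma test_function_B_value:
  assumes w: "test_function w"
  shows "B_value K \<beta> \<theta> w w (L2_form K \<beta> \<theta> (deriv w) (deriv w))"
proof -
  note meas = borel_measurable_continuous_onI[OF test_function_deriv(1)[OF w]]
  obtain D where D: "\<And>x. \<bar>deriv w x\<bar> \<le> D"
    using test_function_deriv(2)[OF w] by (auto simp: bounded_iff)
  have "set_integrable lborel {0<..<1} (\<lambda>x. (deriv w x)\<^sup>2)"
  proof (rule set_integrable_bounded_real)
    show "set_borel_measurable lborel {0<..<1} (\<lambda>x. (deriv w x)\<^sup>2)"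
      using meas by (simp add: set_borel_measurable_def)
    show "\<bar>(deriv w x)\<^sup>2\<bar> \<le> D\<^sup>2" for x
      using D[of x] by (simp add: abs_le_square_iff[symmetric])
  qed auto
  then have "square_integrable (deriv w)"
    using meas by (simp add: square_integrable_def set_borel_measurable_def)
  with w show ?thesis
    by (intro L2_pairing test_function_in_H0 test_function_weak_derivative)
qed

section \<open>A flux opposite to the derivative\<close>

text \<open>
  To the right of the support of \<open>u\<close> the kernel is smooth, and integration by parts moves the
  derivative onto it: with \<open>k s = (x - s) powr (\<beta> - 1)\<close>, the integral of \<open>deriv u * k\<close> is minus that
  of \<open>u * k'\<close>. The bound is uniform in \<open>x\<close> because \<open>x - s < 1\<close> gives
  \<open>(x - s) powr (\<beta> - 2) \<ge> 1\<close>, hence \<open>k' s \<ge> 1 - \<beta>\<close>.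
\<close>

lemma frac_int_left_deriv_le:
  assumes "0 < \<beta>" "\<beta> < 1" and u: "smooth_on UNIV u" "\<And>s. 0 \<le> u s"
    and pq: "0 < p" "p < q" "\<And>s. s \<notin> {p<..<q} \<Longrightarrow> u s = 0"
    and x: "q < x" "x < 1"
  shows "frac_int_left \<beta> (deriv u) x \<le> - ((1 - \<beta>) / Gamma \<beta> * (LINT s:{p..q}|lborel. u s))"
proof -
  have u'_0: "deriv u s = 0" if "s \<notin> {p..q}" for s
    using pq(3) by (intro deriv_eq_0_outside[OF _ that]) auto
  define k k' where "k = (\<lambda>s. (x - s) powr (\<beta> - 1))"
    and "k' = (\<lambda>s. (1 - \<beta>) * (x - s) powr (\<beta> - 2))"
  have k_deriv: "(k has_real_derivative k' s) (at s)" if "s \<le> q" for s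
  proof -
    have "(k has_real_derivative (\<beta> - 1) * (x - s) powr (\<beta> - 1 - 1) * (- 1)) (at s)"
      unfolding k_def
      by (rule DERIV_chain2[OF has_real_derivative_powr])
        (use that x in \<open>auto intro!: derivative_eq_intros\<close>)
    then show ?thesis
      by (simp add: k'_def algebra_simps)
  qed
  have k'_ge: "1 - \<beta> \<le> k' s" if "0 < s" "s \<le> q" for s
  proof -
    have "1 powr (\<beta> - 2) \<le> (x - s) powr (\<beta> - 2)"
      using that x \<open>\<beta> < 1\<close> by (intro powr_mono2') auto
    then show ?thesis
      using \<open>\<beta> < 1\<close> by (simp add: k'_def)
  qed
  have k_cont: "continuous_on {p..q} k" and k'_cont: "continuous_on {p..q} k'"
    using x by (auto simp: k_def k'_def intro!: continuous_intros)
  note u_cont = smooth_continuous[OF u(1)] smooth_continuous[OF smooth_on_deriv[OF u(1)]]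
  have FTC: "has_bochner_integral lborel
      (\<lambda>s. indicator {p..q} s *\<^sub>R (deriv u s * k s + k' s * u s)) (u q * k q - u p * k p)"
  proof (rule has_bochner_integral_FTC_Icc)
    show "((\<lambda>s. u s * k s) has_vector_derivative deriv u s * k s + k' s * u s) (at s within {p..q})"
      if "p \<le> s" "s \<le> q" for s
      unfolding has_real_derivative_iff_has_vector_derivative[symmetric]
      using DERIV_mult[OF smooth_has_real_derivative[OF u(1)] k_deriv] that
      by (blast intro: DERIV_subset)
  qed (use pq in \<open>auto intro!: continuous_intros k_cont k'_cont u_cont\<close>)
  have cont_int: "set_integrable lborel {p..q} f" if "continuous_on {p..q} f" for f :: "real \<Rightarrow> real"
    unfolding set_integrable_def by (rule borel_integrable_compact[OF _ that]) simp
  have int_uk: "set_integrable lborel {p..q} (\<lambda>s. deriv u s * k s)"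
    and int_u: "set_integrable lborel {p..q} (\<lambda>s. (1 - \<beta>) * u s)"
    by (auto intro!: cont_int continuous_intros u_cont k_cont)
  have "(LINT s:{p..q}|lborel. deriv u s * k s) + (1 - \<beta>) * (LINT s:{p..q}|lborel. u s) =
      (LINT s:{p..q}|lborel. deriv u s * k s + (1 - \<beta>) * u s)"
    using set_integral_add(2)[OF int_uk int_u] by simp
  also have "\<dots> \<le> (LINT s:{p..q}|lborel. deriv u s * k s + k' s * u s)"
  proof (rule set_integral_mono)
    show "set_integrable lborel {p..q} (\<lambda>s. deriv u s * k s + (1 - \<beta>) * u s)"
      using set_integral_add(1)[OF int_uk int_u] .
    show "set_integrable lborel {p..q} (\<lambda>s. deriv u s * k s + k' s * u s)"
      by (intro cont_int continuous_intros u_cont k_cont k'_cont)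
    show "deriv u s * k s + (1 - \<beta>) * u s \<le> deriv u s * k s + k' s * u s" if "s \<in> {p..q}" for s
      using that pq(1) k'_ge[of s] u(2)[of s] by (auto intro: mult_right_mono)
  qed
  also have "\<dots> = 0"
    using has_bochner_integral_integral_eq[OF FTC] pq by (simp add: set_lebesgue_integral_def)
  finally have le: "(LINT s:{p..q}|lborel. deriv u s * k s) \<le>
      - ((1 - \<beta>) * (LINT s:{p..q}|lborel. u s))" by simp
  have "(LINT s:{0<..<x}|lborel. deriv u s / (x - s) powr (1 - \<beta>)) =
      (LINT s:{p..q}|lborel. deriv u s * k s)"
    unfolding set_lebesgue_integral_def
  proof (intro Bochner_Integration.integral_cong refl)
    fix s
    show "indicator {0<..<x} s *\<^sub>R (deriv u s / (x - s) powr (1 - \<beta>)) =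
        indicator {p..q} s *\<^sub>R (deriv u s * k s)"
      using pq x u'_0[of s] powr_minus_divide[of "x - s" "1 - \<beta>"]
      by (auto simp: indicator_def k_def)
  qed
  with mult_left_mono[OF le, of "1 / Gamma \<beta>"] show ?thesis
    using Gamma_real_pos[OF \<open>0 < \<beta>\<close>] by (simp add: frac_int_left_def)
qed

text \<open>
  The derivative in question is that of \<open>u x - u (1 - x)\<close>. It is symmetric about \<open>1 / 2\<close>, and seen
  from a point between the two supports each fractional integral meets only one of the bumps. The
  sign in front of the mirrored bump is the one for which the right fractional integral at \<open>x\<close> is the
  left one at \<open>1 - x\<close>, so both are bounded above by the same nonpositive number, and so is every convex
  combination of them.
\<close>

lemma flux_antisymmetric_pair_le:
  assumes "0 < \<beta>" "\<beta> < 1" "0 \<le> \<theta>" "\<theta> \<le> 1"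
    and u: "smooth_on UNIV u" "\<And>s. 0 \<le> u s"
    and pq: "0 < p" "p < q" "\<And>s. s \<notin> {p<..<q} \<Longrightarrow> u s = 0"
    and x: "q < x" "x < 1 - q"
  shows "flux \<beta> \<theta> (\<lambda>s. deriv u s + deriv u (1 - s)) x
    \<le> - ((1 - \<beta>) / Gamma \<beta> * (LINT s:{p..q}|lborel. u s))"
proof -
  let ?g = "\<lambda>s. deriv u s + deriv u (1 - s)"
  let ?c = "(1 - \<beta>) / Gamma \<beta> * (LINT s:{p..q}|lborel. u s)"
  have left: "frac_int_left \<beta> ?g y \<le> - ?c" if y: "q < y" "y < 1 - q" for y
  proof -
    have "deriv u (1 - s) = 0" if "s < y" for s
      using pq(3) that y by (intro deriv_eq_0_outside[of p q]) auto
    then have "frac_int_left \<beta> ?g y = frac_int_left \<beta> (deriv u) y"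
      by (intro frac_int_left_cong) auto
    also have "\<dots> \<le> - ?c"
      using y pq by (intro frac_int_left_deriv_le assms) auto
    finally show ?thesis .
  qed
  have "frac_int_right \<beta> ?g x \<le> - ?c"
    using left[of "1 - x"] x by (simp add: frac_int_right_reflect add.commute)
  with left[OF x] have "flux \<beta> \<theta> ?g x \<le> \<theta> * (- ?c) + (1 - \<theta>) * (- ?c)"
    unfolding flux_def using assms(3,4) by (intro add_mono mult_left_mono) auto
  also have "\<dots> = - ?c"
    by algebra
  finally show ?thesis .
qed

text \<open>
  In a gap between the two bumps of an antisymmetric pair the derivative is zero while the flux is
  negative. A third bump \<open>\<psi>\<close> in the gap gives the total derivative a positive sign on some interval.
  Its own flux may have any sign but is bounded, so it is beaten by taking a large multiple \<open>N\<close> of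
  the pair.
\<close>

lemma test_function_with_adverse_flux:
  assumes "0 < \<beta>" "\<beta> < 1" "0 \<le> \<theta>" "\<theta> \<le> 1"
  obtains w a b where "test_function w" "0 < a" "a < b" "b < 1"
    "\<And>x. a < x \<Longrightarrow> x < b \<Longrightarrow> flux \<beta> \<theta> (deriv w) x * deriv w x < 0"
proof -
  obtain \<eta> :: "real \<Rightarrow> real" where \<eta>: "smooth_on UNIV \<eta>" "\<And>x. 0 \<le> \<eta> x"
    "\<And>x. \<eta> x > 0 \<longleftrightarrow> x \<in> {0<..<1}"
    using smooth_bump by blast
  have \<eta>_0: "\<eta> x = 0" if "x \<notin> {0<..<1}" for x
    using that \<eta>(2,3)[of x] by auto
  \<comment> \<open>The bump rises from \<open>0\<close> to a positive value, so its derivative is positive somewhere.\<close>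
  have "\<exists>z>0. z < 1 / 2 \<and> \<eta> (1 / 2) - \<eta> 0 = (1 / 2 - 0) * deriv \<eta> z"
    by (rule MVT2) (auto intro: smooth_has_real_derivative[OF \<eta>(1)])
  moreover have "\<eta> (1 / 2) > 0" "\<eta> 0 = 0"
    using \<eta>(3) \<eta>_0 by auto
  ultimately obtain z where z: "0 < z" "z < 1 / 2" "deriv \<eta> z > 0"
    by (auto simp: zero_less_mult_iff)
  have "open {x. 0 < deriv \<eta> x}"
    by (intro open_Collect_less continuous_intros smooth_continuous smooth_on_deriv \<eta>)
  then obtain r where r: "r > 0" "cball z r \<subseteq> {x. 0 < deriv \<eta> x}"
    using z(3) open_contains_cball by blast
  define b\<^sub>0 where "b\<^sub>0 = min 1 (z + r)"

  \<comment> \<open>The supports of \<open>u\<close>, \<open>\<psi>\<close> and the mirror image of \<open>u\<close> are the disjoint intervals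
    \<open>[1/10, 3/10]\<close>, \<open>[2/5, 3/5]\<close> and \<open>[7/10, 9/10]\<close>.\<close>
  define u where "u = (\<lambda>x. \<eta> (5 * x + (- 1 / 2)))"
  define \<psi> where "\<psi> = (\<lambda>x. \<eta> (5 * x + (- 2)))"
  have u: "smooth_on UNIV u" and \<psi>: "smooth_on UNIV \<psi>"
    unfolding u_def \<psi>_def by (intro smooth_affine \<eta>)+
  have u_0: "u x = 0" if "x \<notin> {1/10<..<3/10}" for x
    using that unfolding u_def by (intro \<eta>_0) auto
  have \<psi>_0: "\<psi> x = 0" if "x \<notin> {2/5..3/5}" for x
    using that unfolding \<psi>_def by (intro \<eta>_0) auto
  have u'_0: "deriv u x = 0" if "x \<notin> {1/10..3/10}" for x
    using u_0 by (intro deriv_eq_0_outside[OF _ that]) auto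
  have \<psi>'_0: "deriv \<psi> x = 0" if "x \<notin> {2/5..3/5}" for x
    using \<psi>_0 that by (rule deriv_eq_0_outside)
  have \<psi>': "deriv \<psi> x = deriv \<eta> (5 * x + (- 2)) * 5" for x
    unfolding \<psi>_def
    by (intro DERIV_imp_deriv DERIV_chain2[OF smooth_has_real_derivative[OF \<eta>(1)]])
      (auto intro!: derivative_eq_intros)

  define g where "g = (\<lambda>s. deriv u s + deriv u (1 - s))"
  define c where "c = (1 - \<beta>) / Gamma \<beta> * (LINT s:{1/10..3/10}|lborel. u s)"
  have flux_g: "flux \<beta> \<theta> g x \<le> - c" if "3/10 < x" "x < 7/10" for x
    unfolding g_def c_def
    by (rule flux_antisymmetric_pair_le) (use assms u u_0 \<eta>(2) that in \<open>auto simp: u_def\<close>)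
  have "(LINT s:{1/10..3/10}|lborel. - u s) < 0"
  proof (rule set_integral_less_0)
    show "set_integrable lborel {1/10..3/10} (\<lambda>s. - u s)"
      unfolding set_integrable_def
      by (intro borel_integrable_compact continuous_on_minus smooth_continuous u) simp
    show "- u x \<le> 0" for x
      using \<eta>(2) by (simp add: u_def)
    show "- u x < 0" if "x \<in> {1/10<..<3/10}" for x
      using that \<eta>(3) by (simp add: u_def)
  qed auto
  then have "c > 0"
    unfolding c_def using Gamma_real_pos[OF assms(1)] \<open>\<beta> < 1\<close> 
    by (simp add: set_lebesgue_integral_def)

  have g_smooth: "smooth_on UNIV g"
    using smooth_add[OF smooth_on_deriv[OF u] smooth_affine[OF smooth_on_deriv[OF u], of "- 1" 1]]
    by (simp add: g_def)
  have g_0: "g x = 0" if "x \<notin> {1/10..9/10}" for x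
    using that by (auto simp: g_def u'_0)
  have g: "g \<in> borel_measurable borel" "bounded (range g)"
  proof -
    note cont = smooth_continuous[OF g_smooth]
    show "g \<in> borel_measurable borel"
      using cont by (rule borel_measurable_continuous_onI)
    show "bounded (range g)"
      using cont g_0 by (rule bounded_range_compact_support)
  qed
  have d\<psi>: "deriv \<psi> \<in> borel_measurable borel" "bounded (range (deriv \<psi>))"
  proof -
    note cont = smooth_continuous[OF smooth_on_deriv[OF \<psi>]]
    show "deriv \<psi> \<in> borel_measurable borel"
      using cont by (rule borel_measurable_continuous_onI)
    show "bounded (range (deriv \<psi>))"
      using cont \<psi>'_0 by (rule bounded_range_compact_support)
  qed
  obtain C where C: "\<And>x. x \<in> {0<..<1} \<Longrightarrow> \<bar>flux \<beta> \<theta> (deriv \<psi>) x\<bar> \<le> C"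
    using flux_bounded[OF assms(1) d\<psi>] by blast
  define N where "N = (\<bar>C\<bar> + 1) / c"

  define w where "w = (\<lambda>x. N * (u x + (- 1) * u ((- 1) * x + 1)) + \<psi> x)"
  have "smooth_on UNIV w"
    unfolding w_def by (intro smooth_add smooth_mult smooth_const smooth_affine u \<psi>)
  moreover have "w x = 0" if "x \<notin> {1/10..9/10}" for x
  proof -
    have "u x = 0" "u ((- 1) * x + 1) = 0" "\<psi> x = 0"
      using that by (auto intro!: u_0 \<psi>_0)
    then show ?thesis by (simp add: w_def)
  qed
  ultimately have test: "test_function w"
    unfolding test_function_def
    by (intro conjI exI[of _ "1/10"] exI[of _ "9/10"]) auto
  have w': "deriv w = (\<lambda>s. N * g s + deriv \<psi> s)"
  proof (intro ext DERIV_imp_deriv)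
    fix s
    have "((\<lambda>x. u ((- 1) * x + 1)) has_real_derivative deriv u ((- 1) * s + 1) * (- 1)) (at s)"
      by (rule DERIV_chain2[OF smooth_has_real_derivative[OF u]])
        (auto intro!: derivative_eq_intros)
    from DERIV_add[OF DERIV_cmult[OF DERIV_add[OF smooth_has_real_derivative[OF u]
            DERIV_cmult[OF this, of "- 1"]], of N] smooth_has_real_derivative[OF \<psi>]]
    show "(w has_real_derivative N * g s + deriv \<psi> s) (at s)"
      unfolding w_def by (simp add: g_def)
  qed

  show ?thesis
  proof (rule that[OF test])
    show "0 < (z + 2) / 5" "(z + 2) / 5 < (b\<^sub>0 + 2) / 5" "(b\<^sub>0 + 2) / 5 < 1"
      using z r(1) by (auto simp: b\<^sub>0_def min_def)
    fix x assume x: "(z + 2) / 5 < x" "x < (b\<^sub>0 + 2) / 5"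
    then have x': "2/5 < x" "x < 3/5"
      using z(1) by (auto simp: b\<^sub>0_def)
    have "5 * x + (- 2) \<in> cball z r"
      using x by (auto simp: b\<^sub>0_def dist_real_def)
    then have "deriv \<psi> x > 0"
      using r(2) by (auto simp: \<psi>')
    moreover have "g x = 0"
      using x' by (simp add: g_def u'_0)
    moreover have "flux \<beta> \<theta> (deriv w) x < 0"
    proof -
      have "flux \<beta> \<theta> (deriv w) x = N * flux \<beta> \<theta> g x + flux \<beta> \<theta> (deriv \<psi>) x"
        unfolding w' by (rule flux_linear[OF assms(1) g d\<psi>])
      also have "\<dots> \<le> N * (- c) + C"
        using flux_g[of x] C[of x] x' \<open>c > 0\<close>
        by (intro add_mono mult_left_mono) (auto simp: N_def)
      also have "\<dots> < 0"
        using \<open>c > 0\<close> by (simp add: N_def)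
      finally show ?thesis .
    qed
    ultimately show "flux \<beta> \<theta> (deriv w) x * deriv w x < 0"
      by (simp add: w' mult_neg_pos)
  qed
qed

section \<open>Diffusivities with large contrast\<close>

text \<open>
  The integrand without \<open>K\<close> has a total of unknown sign, but it is negative on \<open>(a', b')\<close>. Raising
  the diffusivity on \<open>(a, b)\<close> by \<open>k - 1\<close> adds \<open>k - 1\<close> times a negative number. What \<open>K\<close> does in the
  two layers between \<open>(a, b)\<close> and the complement of \<open>(a', b')\<close> is left open: as \<open>K \<ge> 1\<close> there and
  the integrand is negative, it can only help. This freedom admits a jump and a smooth transition
  with the same \<open>k\<close>.
\<close>

lemma L2_form_negative_for_large_contrast:
  assumes "0 < \<beta>" and w: "test_function w"
    and ab: "0 < a'" "a' < a" "a < b" "b < b'" "b' < 1"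
    and neg: "\<And>x. a' < x \<Longrightarrow> x < b' \<Longrightarrow> flux \<beta> \<theta> (deriv w) x * deriv w x < 0"
  obtains k where "1 < k"
    "\<And>K. K \<in> borel_measurable borel \<Longrightarrow> (\<And>x. 1 \<le> K x \<and> K x \<le> k) \<Longrightarrow>
      (\<And>x. a < x \<Longrightarrow> x < b \<Longrightarrow> K x = k) \<Longrightarrow> (\<And>x. x \<notin> {a'<..<b'} \<Longrightarrow> K x = 1) \<Longrightarrow>
      L2_form K \<beta> \<theta> (deriv w) (deriv w) < 0"
proof -
  define G where "G = (\<lambda>x. flux \<beta> \<theta> (deriv w) x * deriv w x)"
  note form = L2_form_eq_flux[OF \<open>0 < \<beta>\<close>
      borel_measurable_continuous_onI[OF test_function_deriv(1)[OF w]] test_function_deriv(2)[OF w],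
      of _ _ \<theta>, folded G_def fun_cong[OF G_def]]
  have G_int: "set_integrable lborel {0<..<1} G"
    using form(2)[of "\<lambda>x. 1" 1] by simp
  have G_int_ab: "set_integrable lborel {a<..<b} G"
    using G_int by (rule set_integrable_subset) (use ab in auto)
  define d where "d = - (LINT x:{a<..<b}|lborel. G x)"
  have "(LINT x:{a<..<b}|lborel. G x) < 0"
    using G_int_ab ab(3) neg ab by (intro set_integral_less_0[of _ _ a b]) (auto simp: G_def less_imp_le)
  then have "d > 0" by (simp add: d_def)
  define J where "J = (LINT x:{0<..<1}|lborel. G x)"
  \<comment> \<open>Chosen to make \<open>J - (k - 1) * d = J - \<bar>J\<bar> - 1\<close> negative.\<close>
  define k where "k = 1 + (\<bar>J\<bar> + 1) / d"
  have "1 < k"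
    using \<open>d > 0\<close> by (simp add: k_def)
  then show ?thesis
  proof (rule that)
    fix K :: "real \<Rightarrow> real"
    assume K: "K \<in> borel_measurable borel" "\<And>x. 1 \<le> K x \<and> K x \<le> k"
      "\<And>x. a < x \<Longrightarrow> x < b \<Longrightarrow> K x = k" "\<And>x. x \<notin> {a'<..<b'} \<Longrightarrow> K x = 1"
    have bound: "\<bar>K x\<bar> \<le> k" for x
      using K(2)[of x] by simp
    have extra_int: "set_integrable lborel {0<..<1} (\<lambda>x. (k - 1) * (indicator {a<..<b} x * G x))"
      and extra: "(LINT x:{0<..<1}|lborel. indicator {a<..<b} x * G x) = - d"
    proof -
      have eq: "indicator {0<..<1} x *\<^sub>R (indicator {a<..<b} x * G x) = indicator {a<..<b} x *\<^sub>R G x" for x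
        using ab by (auto simp: indicator_def)
      have "set_integrable lborel {0<..<1} (\<lambda>x. indicator {a<..<b} x * G x)"
        using G_int_ab unfolding set_integrable_def eq .
      then show "set_integrable lborel {0<..<1} (\<lambda>x. (k - 1) * (indicator {a<..<b} x * G x))"
        by (rule set_integrable_mult_right)
      show "(LINT x:{0<..<1}|lborel. indicator {a<..<b} x * G x) = - d"
        unfolding d_def set_lebesgue_integral_def eq by simp
    qed
    have "L2_form K \<beta> \<theta> (deriv w) (deriv w) = (LINT x:{0<..<1}|lborel. K x * G x)"
      using form(1)[OF K(1) bound] .
    also have "\<dots> \<le> (LINT x:{0<..<1}|lborel. G x + (k - 1) * (indicator {a<..<b} x * G x))"
    proof (rule set_integral_mono)
      show "set_integrable lborel {0<..<1} (\<lambda>x. K x * G x)"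
        using form(2)[OF K(1) bound] .
      show "set_integrable lborel {0<..<1} (\<lambda>x. G x + (k - 1) * (indicator {a<..<b} x * G x))"
        using G_int extra_int by (rule set_integral_add(1))
      fix x :: real
      consider "x \<notin> {a'<..<b'}" | "x \<in> {a<..<b}" | "x \<in> {a'<..<b'}" "x \<notin> {a<..<b}"
        by blast
      then show "K x * G x \<le> G x + (k - 1) * (indicator {a<..<b} x * G x)"
      proof cases
        case 1
        then have "x \<notin> {a<..<b}" using ab by auto
        with 1 K(4) show ?thesis by simp
      next
        case 2
        with K(3) show ?thesis by (simp add: algebra_simps)
      next
        case 3
        then have "G x < 0" using neg by (simp add: G_def)
        with 3 K(2)[of x] show ?thesis by simp
      qed
    qed
    also have "\<dots> = J - (k - 1) * d"
      unfolding set_integral_add(2)[OF G_int extra_int] set_integral_mult_right extra J_def by simp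
    also have "\<dots> < 0"
      using \<open>d > 0\<close> by (simp add: k_def)
    finally show "L2_form K \<beta> \<theta> (deriv w) (deriv w) < 0" .
  qed
qed

theorem lemma3p3:
  fixes \<beta> \<theta> :: real
  assumes "0 < \<beta>" and "\<beta> < 1" and "0 \<le> \<theta>" and "\<theta> \<le> 1"
  shows "(\<exists>K. diffusivity K \<and> (\<exists>w\<in>H0 (1 - \<beta> / 2). \<exists>y<0. B_value K \<beta> \<theta> w w y)) \<and>
    (\<exists>a b k1 k2 k3. 0 < a \<and> a < b \<and> b < 1 \<and> 0 < k1 \<and> 0 < k2 \<and> 0 < k3 \<and> k1 \<noteq> k2 \<and> k2 \<noteq> k3 \<and>
       (\<exists>w\<in>H0 (1 - \<beta> / 2). \<exists>y<0. B_value (three_piece a b k1 k2 k3) \<beta> \<theta> w w y) \<and>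
       (\<forall>\<delta>>0. \<exists>K. diffusivity K \<and> smooth_modification \<delta> a b k1 k2 k3 K \<and>
          (\<exists>w\<in>H0 (1 - \<beta> / 2). \<exists>y<0. B_value K \<beta> \<theta> w w y)))"
proof -
  obtain w a' b' where w: "test_function w" and a'b': "0 < a'" "a' < b'" "b' < 1"
    and neg: "\<And>x. a' < x \<Longrightarrow> x < b' \<Longrightarrow> flux \<beta> \<theta> (deriv w) x * deriv w x < 0"
    using test_function_with_adverse_flux[OF assms] by blast
  define a b where "a = (2 * a' + b') / 3" and "b = (a' + 2 * b') / 3"
  have ab: "a' < a" "a < b" "b < b'"
    using a'b' by (auto simp: a_def b_def)
  obtain k where "1 < k" and form_neg: "\<And>K. K \<in> borel_measurable borel \<Longrightarrow>
      (\<And>x. 1 \<le> K x \<and> K x \<le> k) \<Longrightarrow> (\<And>x. a < x \<Longrightarrow> x < b \<Longrightarrow> K x = k) \<Longrightarrow>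
      (\<And>x. x \<notin> {a'<..<b'} \<Longrightarrow> K x = 1) \<Longrightarrow> L2_form K \<beta> \<theta> (deriv w) (deriv w) < 0"
    using L2_form_negative_for_large_contrast[OF assms(1) w a'b'(1) ab a'b'(3) neg] by blast
  have B_neg: "\<exists>w\<in>H0 (1 - \<beta> / 2). \<exists>y<0. B_value K \<beta> \<theta> w w y"
    if "L2_form K \<beta> \<theta> (deriv w) (deriv w) < 0" for K
    using test_function_in_H0[OF w] test_function_B_value[OF w] that by blast
  have step: "\<exists>w\<in>H0 (1 - \<beta> / 2). \<exists>y<0. B_value (three_piece a b 1 k 1) \<beta> \<theta> w w y"
  proof (intro B_neg form_neg)
    show "three_piece a b 1 k 1 \<in> borel_measurable borel"
      unfolding three_piece_def[abs_def] by measurable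
  qed (use ab \<open>1 < k\<close> in \<open>auto simp: three_piece_def\<close>)
  have smooth: "\<exists>K. diffusivity K \<and> smooth_modification \<delta> a b 1 k 1 K \<and>
      (\<exists>w\<in>H0 (1 - \<beta> / 2). \<exists>y<0. B_value K \<beta> \<theta> w w y)" if "\<delta> > 0" for \<delta>
  proof -
    \<comment> \<open>The transition layers are at most \<open>\<delta>\<close> wide and stay inside \<open>(a', b')\<close>, where the integrand
      is negative.\<close>
    define \<epsilon> where "\<epsilon> = Min {\<delta>, a - a', b' - b}"
    have \<epsilon>: "0 < \<epsilon>" "\<epsilon> \<le> \<delta>" "\<epsilon> \<le> a - a'" "\<epsilon> \<le> b' - b"
      using ab \<open>\<delta> > 0\<close> by (auto simp: \<epsilon>_def)
    obtain S :: "real \<Rightarrow> real" where S: "smooth_on UNIV S" "\<And>x. 0 \<le> S x" "\<And>x. S x \<le> 1"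
      "\<And>x. a \<le> x \<Longrightarrow> x \<le> b \<Longrightarrow> S x = 1"
      "\<And>x. x \<le> a - \<epsilon> \<Longrightarrow> S x = 0" "\<And>x. b + \<epsilon> \<le> x \<Longrightarrow> S x = 0"
      using smooth_plateau[OF \<epsilon>(1)] by blast
    define K where "K = (\<lambda>x. 1 + (k - 1) * S x)"
    have K_smooth: "smooth_on UNIV K"
      unfolding K_def by (intro smooth_add smooth_mult smooth_const S)
    have K_meas: "K \<in> borel_measurable borel"
      by (intro borel_measurable_continuous_onI smooth_continuous K_smooth)
    have K_range: "1 \<le> K x \<and> K x \<le> k" for x
    proof
      show "1 \<le> K x"
        using S(2) \<open>1 < k\<close> by (simp add: K_def)
      have "K x \<le> 1 + (k - 1) * 1"
        unfolding K_def using S(3) \<open>1 < k\<close> by (intro add_left_mono mult_left_mono) auto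
      then show "K x \<le> k"
        by simp
    qed
    have "diffusivity K"
      unfolding diffusivity_def
    proof
      show "set_borel_measurable lborel {0<..<1} K"
        using K_meas by (simp add: set_borel_measurable_def)
      show "\<exists>m M. 0 < m \<and> (\<forall>x\<in>{0<..<1}. m \<le> K x \<and> K x \<le> M)"
        using K_range by (intro exI[of _ 1] exI[of _ k]) auto
    qed
    moreover have "smooth_modification \<delta> a b 1 k 1 K"
      unfolding smooth_modification_def
    proof (intro conjI ballI impI)
      show "smooth_on {0<..<1} K"
        using K_smooth by (rule smooth_on_subset) simp
      show "K x = three_piece a b 1 k 1 x" if "\<bar>x - a\<bar> \<ge> \<delta> \<and> \<bar>x - b\<bar> \<ge> \<delta>" for x
        using that \<epsilon>(2) S(4-6)[of x] by (auto simp: K_def three_piece_def)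
      show "Min {1, k, 1} \<le> K x" "K x \<le> Max {1, k, 1}" for x
        using K_range[of x] \<open>1 < k\<close> by auto
    qed
    moreover have "L2_form K \<beta> \<theta> (deriv w) (deriv w) < 0"
    proof (rule form_neg[OF K_meas K_range])
      show "K x = k" if "a < x" "x < b" for x
        using that by (simp add: K_def S(4))
      show "K x = 1" if "x \<notin> {a'<..<b'}" for x
        using that \<epsilon>(3,4) S(5,6)[of x] by (auto simp: K_def)
    qed
    ultimately show ?thesis
      using B_neg by blast
  qed
  have "0 < a \<and> a < b \<and> b < 1 \<and> 0 < (1::real) \<and> 0 < k \<and> 0 < (1::real) \<and> 1 \<noteq> k \<and> k \<noteq> 1"
    using ab a'b' \<open>1 < k\<close> by auto
  with step smooth have "\<exists>a b k1 k2 k3. 0 < a \<and> a < b \<and> b < 1 \<and> 0 < k1 \<and> 0 < k2 \<and> 0 < k3 \<and>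
      k1 \<noteq> k2 \<and> k2 \<noteq> k3 \<and>
      (\<exists>w\<in>H0 (1 - \<beta> / 2). \<exists>y<0. B_value (three_piece a b k1 k2 k3) \<beta> \<theta> w w y) \<and>
      (\<forall>\<delta>>0. \<exists>K. diffusivity K \<and> smooth_modification \<delta> a b k1 k2 k3 K \<and>
        (\<exists>w\<in>H0 (1 - \<beta> / 2). \<exists>y<0. B_value K \<beta> \<theta> w w y))"
    by blast
  moreover have "\<exists>K. diffusivity K \<and> (\<exists>w\<in>H0 (1 - \<beta> / 2). \<exists>y<0. B_value K \<beta> \<theta> w w y)"
    using smooth[OF zero_less_one] by blast
  ultimately show ?thesis by (rule conjI[rotated])
qed

end
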